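(* Let $p\ge 2$, $K\ge 1$, $T$ be integers with $p+K<T$, and let $\mathbf{X}_t=\mathbf{B}\mathbf{f}_t+\mathbf{u}_t$, $t=1,\dots,T$, be the factor model described in the context, with $\mathbf{f}_t$ and $\mathbf{u}_t$ independent and normally distributed and with $\boldsymbol{\Sigma}_u=\mathrm{cov}(\mathbf{u}_t)$ a diagonal matrix. Let $$T_{pr}=\max_{1\le j\le p}T_j,\qquad T_j=\frac{T-K-p+1}{p-1}\big(v_{jj}v_{jj}^{(-)}-1\big).$$ Then under $H_0:\ \boldsymbol{\Omega}_{11}=\mathrm{diag}(\omega_{11},\dots,\omega_{pp})$ the distribution of $T_{pr}$ does not depend on $\omega_{11},\dots,\omega_{pp}$; that is, with $p,K,T$, $\mathbf{B}$ and $\mathrm{cov}(\mathbf{f}_t)$ held fixed, the law of $T_{pr}$ is the same for all choices of positive numbers $\omega_{11},\dots,\omega_{pp}$.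
   Context: Model: $\mathbf{B}$ is a deterministic $p\times K$ matrix; $\mathbf{f}_1,\dots,\mathbf{f}_T$ are i.i.d. $K$-dimensional normal vectors with mean zero and positive definite covariance matrix; $\mathbf{u}_1,\dots,\mathbf{u}_T$ are i.i.d. $p$-dimensional normal vectors with mean zero and positive definite covariance matrix $\boldsymbol{\Sigma}_u$; the sequences $(\mathbf{f}_t)$ and $(\mathbf{u}_t)$ are independent. Put $\mathbf{Y}_t=(\mathbf{X}_t^\top,\mathbf{f}_t^\top)^\top\in\mathbb{R}^{p+K}$ and $\boldsymbol{\Omega}=\{\mathrm{cov}(\mathbf{Y}_t)\}^{-1}=(\omega_{ij})$, with upper-left $p\times p$ block $\boldsymbol{\Omega}_{11}$. Let $\mathbf{Y}=(\mathbf{Y}_1,\dots,\mathbf{Y}_T)$, $\mathbf{S}=\frac1T\mathbf{Y}\mathbf{Y}^\top$, $\mathbf{V}=(T\mathbf{S})^{-1}=(v_{ij})$, with upper-left $p\times p$ block $\mathbf{V}_{11}$; write $\mathbf{V}_{11}^{-1}=(v_{ij}^{(-)})_{1\le i,j\le p}$. *)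

theory Defs
  imports "HOL-Probability.Probability"
begin

definition pos_def_matrix :: "real ^ 'n ^ 'n \<Rightarrow> bool" where
  "pos_def_matrix A \<longleftrightarrow> transpose A = A \<and> (\<forall>x. x \<noteq> 0 \<longrightarrow> x \<bullet> (A *v x) > 0)"

definition diagonal_matrix :: "real ^ 'n ^ 'n \<Rightarrow> bool" where
  "diagonal_matrix A \<longleftrightarrow> (\<forall>i j. i \<noteq> j \<longrightarrow> A $ i $ j = 0)"

definition diag :: "real ^ 'n \<Rightarrow> real ^ 'n ^ 'n" where
  "diag d = (\<chi> i j. if i = j then d $ i else 0)"

definition stack :: "real ^ 'p \<Rightarrow> real ^ 'k \<Rightarrow> real ^ ('p + 'k)" where
  "stack x y = (\<chi> i. case i of Inl j \<Rightarrow> x $ j | Inr l \<Rightarrow> y $ l)"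

definition upper_left :: "real ^ ('p::finite + 'k::finite) ^ ('p + 'k) \<Rightarrow> real ^ 'p ^ 'p" where
  "upper_left A = (\<chi> i j. A $ Inl i $ Inl j)"

definition cov_matrix :: "'a measure \<Rightarrow> ('a \<Rightarrow> real ^ 'n) \<Rightarrow> real ^ 'n ^ 'n" where
  "cov_matrix M X = (\<chi> i j. \<integral>w. (X w $ i - (\<integral>v. X v $ i \<partial>M)) * (X w $ j - (\<integral>v. X v $ j \<partial>M)) \<partial>M)"

definition mv_normal_density :: "real ^ 'n \<Rightarrow> real ^ 'n ^ 'n \<Rightarrow> real ^ 'n \<Rightarrow> real" where
  "mv_normal_density \<mu> \<Sigma> x =
     exp (- ((x - \<mu>) \<bullet> (matrix_inv \<Sigma> *v (x - \<mu>))) / 2) / sqrt ((2 * pi) ^ CARD('n) * det \<Sigma>)"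

text \<open>The nondegenerate normal law with mean \<open>\<mu>\<close> and positive definite covariance matrix \<open>\<Sigma>\<close>.\<close>

definition mv_normal :: "'a measure \<Rightarrow> ('a \<Rightarrow> real ^ 'n) \<Rightarrow> real ^ 'n \<Rightarrow> real ^ 'n ^ 'n \<Rightarrow> bool" where
  "mv_normal M X \<mu> \<Sigma> \<longleftrightarrow>
     pos_def_matrix \<Sigma> \<and> distributed M lborel X (\<lambda>x. ennreal (mv_normal_density \<mu> \<Sigma> x))"

text \<open>The finite index types \<open>'p\<close>, \<open>'k\<close> and \<open>'t\<close> enumerate the \<open>p\<close> coordinates of
  the observations, the \<open>K\<close> factors and the \<open>T\<close> time points. Independence of the
  two whole sequences is stated through the sigma-algebras they generate, since
  \<^const>\<open>prob_space.indep_var\<close> requires both variables to take values in the same type.\<close>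

locale factor_model = prob_space M
  for M :: "'a measure"
    and B :: "real ^ 'k ^ 'p"
    and \<Sigma>f :: "real ^ 'k ^ 'k"
    and \<Sigma>u :: "real ^ 'p ^ 'p"
    and f :: "'t::finite \<Rightarrow> 'a \<Rightarrow> real ^ 'k"
    and u :: "'t \<Rightarrow> 'a \<Rightarrow> real ^ 'p"
    and X :: "'t \<Rightarrow> 'a \<Rightarrow> real ^ 'p" +
  assumes f_normal: "\<And>t. mv_normal M (f t) 0 \<Sigma>f"
    and u_normal: "\<And>t. mv_normal M (u t) 0 \<Sigma>u"
    and f_indep: "indep_vars (\<lambda>_. borel) f UNIV"
    and u_indep: "indep_vars (\<lambda>_. borel) u UNIV"
    and fu_indep: "indep_set
      (sets (vimage_algebra (space M) (\<lambda>w t. f t w) (PiM UNIV (\<lambda>_. borel))))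
      (sets (vimage_algebra (space M) (\<lambda>w t. u t w) (PiM UNIV (\<lambda>_. borel))))"
    and X_eq: "\<And>t w. X t w = B *v f t w + u t w"

definition obs :: "('t \<Rightarrow> 'a \<Rightarrow> real ^ 'p) \<Rightarrow> ('t \<Rightarrow> 'a \<Rightarrow> real ^ 'k) \<Rightarrow> 't \<Rightarrow> 'a \<Rightarrow> real ^ ('p + 'k)" where
  "obs X f t w = stack (X t w) (f t w)"

definition precision_matrix :: "'a measure \<Rightarrow> ('a \<Rightarrow> real ^ 'n) \<Rightarrow> real ^ 'n ^ 'n" where
  "precision_matrix M Y = matrix_inv (cov_matrix M Y)"

definition data_matrix :: "('t \<Rightarrow> 'a \<Rightarrow> real ^ 'n) \<Rightarrow> 'a \<Rightarrow> real ^ 't ^ 'n" where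
  "data_matrix Y w = (\<chi> i t. Y t w $ i)"

definition sample_cov :: "real ^ 't ^ 'n \<Rightarrow> real ^ 'n ^ 'n" where
  "sample_cov Y = (1 / real CARD('t)) *\<^sub>R (Y ** transpose Y)"

text \<open>On singular arguments \<^const>\<open>matrix_inv\<close> is one fixed unspecified matrix, so it is a
  total Borel function; in the situation of interest the matrices below are almost surely
  invertible.\<close>

definition V_matrix :: "real ^ 't ^ 'n \<Rightarrow> real ^ 'n ^ 'n" where
  "V_matrix Y = matrix_inv (real CARD('t) *\<^sub>R sample_cov Y)"

definition T_comp :: "real ^ 't ^ ('p::finite + 'k::finite) \<Rightarrow> 'p \<Rightarrow> real" where
  "T_comp Y j =
     (let V11 = upper_left (V_matrix Y) in
        (real CARD('t) - real CARD('k) - real CARD('p) + 1) / (real CARD('p) - 1) *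
        (V11 $ j $ j * matrix_inv V11 $ j $ j - 1))"

definition T_pr :: "real ^ 't ^ ('p::finite + 'k::finite) \<Rightarrow> real" where
  "T_pr Y = (MAX j\<in>UNIV. T_comp Y j)"

end

theory Submission
  imports Defs
begin

text \<open>The law of \<^const>\<open>T_pr\<close> depends on nothing but the dimensions and the covariance matrix of
  the factors, because \<^const>\<open>T_pr\<close> is invariant under the linear maps that relate different
  models.

  Since \<open>\<Sigma>\<^sub>u\<close> is diagonal with positive entries \<open>s\<^sub>j\<^sup>2\<close>, the vectors \<open>N\<^sub>t = diag(1/s) u\<^sub>t\<close> are
  standard normal (\<open>distr_standardised_normal\<close>), and the observation is
  \<open>(X\<^sub>t, f\<^sub>t) = G (N\<^sub>t, f\<^sub>t)\<close>, where \<open>G\<close> is the block matrix with rows \<open>(diag s, B)\<close> and \<open>(0, I)\<close>.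
  When \<open>Z Z\<^sup>T\<close> is invertible, passing from data \<open>Z\<close> to data \<open>G Z\<close> replaces \<open>V = (Z Z\<^sup>T)\<^sup>-\<^sup>1\<close> by a matrix \<open>V'\<close> with
  \<open>V = G\<^sup>T V' G\<close>. Because \<open>G e\<^sub>j = s\<^sub>j e\<^sub>j\<close> for the first \<open>p\<close> basis vectors, this gives
  \<open>V\<^sub>1\<^sub>1 = diag(s) V'\<^sub>1\<^sub>1 diag(s)\<close> on the upper-left blocks; the loadings have disappeared.
  Hence the \<open>j\<close>-th diagonal entry of \<open>V\<^sub>1\<^sub>1\<close> is \<open>s\<^sub>j\<^sup>2\<close> times that of \<open>V'\<^sub>1\<^sub>1\<close>, and the \<open>j\<close>-th diagonal
  entry of the inverse of \<open>V\<^sub>1\<^sub>1\<close> is \<open>s\<^sub>j\<^sup>-\<^sup>2\<close> times that of the inverse of \<open>V'\<^sub>1\<^sub>1\<close>: the product, and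
  with it every \<open>T\<^sub>j\<close>, is unchanged (\<open>T_comp_row_transform\<close>, \<open>T_pr_factor_invariant\<close>).
  If \<open>Z Z\<^sup>T\<close> is singular, so is \<open>(G Z) (G Z)\<^sup>T\<close>; both inverses are then the same default value,
  and the invariance is trivial.

  So \<^const>\<open>T_pr\<close> of the data equals, pointwise on the sample space, \<^const>\<open>T_pr\<close> of the
  standardised data. By independence the joint law of \<open>((f\<^sub>t), (N\<^sub>t))\<close> is the product of the laws of the
  \<open>f\<^sub>t\<close> and of standard normal laws (\<open>distr_T_pr\<close>), which is the same in both models.\<close>

section \<open>Inverse matrices under congruence\<close>

lemma matrix_inv_mult_self:
  fixes A :: "real ^ 'n ^ 'n"
  assumes "invertible A"
  shows "A ** matrix_inv A = mat 1" and "matrix_inv A ** A = mat 1"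
  using someI_ex[OF assms[unfolded invertible_def]] by (simp_all add: matrix_inv_def)

lemma matrix_inv_eqI:
  fixes A :: "real ^ 'n ^ 'n"
  assumes "A ** C = mat 1"
  shows "matrix_inv A = C"
proof -
  have "invertible A" using assms invertible_right_inverse by blast
  then show ?thesis
    using matrix_inv_mult_self[of A] assms
    by (metis matrix_mul_assoc matrix_mul_lid matrix_mul_rid)
qed

text \<open>All singular matrices of one size have the same default value as inverse.\<close>

lemma matrix_inv_singular:
  fixes A :: "real ^ 'n ^ 'n"
  assumes "\<not> invertible A"
  shows "matrix_inv A = (SOME C. False)"
proof -
  have "(\<lambda>C. A ** C = mat 1 \<and> C ** A = mat 1) = (\<lambda>C. False)"
    using assms unfolding invertible_def by blast
  then show ?thesis unfolding matrix_inv_def by simp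
qed

lemma invertible_congruence_iff:
  fixes A G :: "real ^ 'n ^ 'n"
  assumes "invertible G"
  shows "invertible (G ** A ** transpose G) \<longleftrightarrow> invertible A"
  using assms by (auto simp: invertible_det_nz det_mul)

text \<open>Stated so that the inverse of \<open>G\<close> does not appear: the inverse of \<open>A\<close> is recovered from
  that of \<open>G A G\<^sup>T\<close>.\<close>

lemma matrix_inv_congruence:
  fixes A G :: "real ^ 'n ^ 'n"
  assumes "invertible A" "invertible G"
  shows "matrix_inv A = transpose G ** matrix_inv (G ** A ** transpose G) ** G"
proof (rule matrix_inv_eqI)
  define W where "W = G ** A ** transpose G"
  have "invertible W" using assms by (simp add: W_def invertible_congruence_iff)
  then have "G ** (A ** (transpose G ** matrix_inv W)) = mat 1"
    using matrix_inv_mult_self(1)[of W] by (simp add: W_def matrix_mul_assoc)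
  then have "A ** (transpose G ** matrix_inv W) ** G = mat 1"
    by (rule matrix_left_right_inverse1)
  then show "A ** (transpose G ** matrix_inv (G ** A ** transpose G) ** G) = mat 1"
    by (simp add: W_def matrix_mul_assoc)
qed

text \<open>If \<open>G e\<^sub>i = a e\<^sub>i\<close> and \<open>G e\<^sub>j = b e\<^sub>j\<close>, then the bilinear form of \<open>V\<close>, pulled back along \<open>G\<close>,
  only gets its \<open>(i, j)\<close> entry multiplied by \<open>a b\<close>; the other columns of \<open>G\<close> are irrelevant.\<close>

lemma congruence_entry_scaled_columns:
  fixes G V :: "real ^ 'n ^ 'n"
  assumes "column i G = a *s axis i 1" "column j G = b *s axis j 1"
  shows "(transpose G ** V ** G) $ i $ j = a * b * V $ i $ j"
proof -
  have "G $ k $ i = (if k = i then a else 0)" "G $ k $ j = (if k = j then b else 0)" for k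
    using assms[THEN arg_cong, of "\<lambda>v. v $ k"] by (auto simp: column_def axis_def)
  then show ?thesis
    by (simp add: matrix_matrix_mult_def transpose_def if_distrib[of "\<lambda>x. x * _"] if_distrib[of "\<lambda>x. _ * x"]
        cong: if_cong)
qed

section \<open>The diagonal blocks of an inverse Gram matrix\<close>

lemma sum_UNIV_Plus:
  fixes g :: "'p::finite + 'k::finite \<Rightarrow> 'c::comm_monoid_add"
  shows "(\<Sum>i\<in>UNIV. g i) = (\<Sum>j\<in>UNIV. g (Inl j)) + (\<Sum>l\<in>UNIV. g (Inr l))"
  using sum.Plus[of "UNIV :: 'p set" "UNIV :: 'k set" g] by (simp add: comp_def)

text \<open>Here \<open>V = (Y Y\<^sup>T)\<^sup>-\<^sup>1\<close> is positive definite, hence so is its upper-left block: a vector \<open>x\<close> with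
  \<open>V\<^sub>1\<^sub>1 x = 0\<close>, padded by zeros to \<open>z\<close>, satisfies \<open>0 = z \<bullet> V z = |Y\<^sup>T V z|\<^sup>2\<close>, so that
  \<open>z = (Y Y\<^sup>T) V z = 0\<close>.\<close>

lemma invertible_upper_left_matrix_inv_gram:
  fixes Y :: "real ^ 't ^ ('p::finite + 'k::finite)"
  assumes "invertible (Y ** transpose Y)"
  shows "invertible (upper_left (matrix_inv (Y ** transpose Y)))"
proof -
  define V where "V = matrix_inv (Y ** transpose Y)"
  have "x = 0" if x: "upper_left V *v x = 0" for x
  proof -
    define z where "z = stack x (0 :: real ^ 'k)"
    define y where "y = V *v z"
    have Wy: "(Y ** transpose Y) *v y = z"
      by (simp add: y_def V_def matrix_vector_mul_assoc matrix_inv_mult_self[OF assms])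
    have "z \<bullet> y = x \<bullet> (upper_left V *v x)"
      by (simp add: z_def y_def stack_def inner_vec_def matrix_vector_mult_def upper_left_def
          sum_UNIV_Plus)
    then have "z \<bullet> y = 0" using x by simp
    moreover have "z \<bullet> y = (transpose Y *v y) \<bullet> (transpose Y *v y)"
      unfolding Wy[symmetric]
      by (metis dot_lmul_matrix matrix_vector_mul_assoc transpose_matrix_vector transpose_transpose)
    ultimately have "transpose Y *v y = 0" by simp
    then have "(Y ** transpose Y) *v y = 0"
      by (simp flip: matrix_vector_mul_assoc)
    then have "z = 0" using Wy by simp
    then show "x = 0"
      by (metis (no_types, lifting) old.sum.simps(5) stack_def vec_eq_iff vec_lambda_beta zero_index z_def)
  qed
  then show ?thesis
    unfolding V_def[symmetric] invertible_left_inverse matrix_left_invertible_ker by blast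
qed

section \<open>Invariance of the statistic under row transformations\<close>

lemma V_matrix_eq: "V_matrix Y = matrix_inv (Y ** transpose Y)"
  by (simp add: V_matrix_def sample_cov_def)

lemma diag_column: "column j (diag d) = d $ j *s axis j 1"
  by (simp add: column_def diag_def axis_def vec_eq_iff)

lemma transpose_diag: "transpose (diag d) = diag d"
  by (auto simp: transpose_def diag_def vec_eq_iff)

lemma invertible_diag:
  assumes "\<And>j. d $ j \<noteq> 0"
  shows "invertible (diag d)"
  using assms by (simp add: invertible_det_nz det_diagonal diag_def)

text \<open>In the invertible case \<open>v\<^sub>j\<^sub>j\<close> is divided and \<open>v\<^sub>j\<^sub>j\<^sup>(\<^sup>-\<^sup>)\<close> is multiplied by \<open>d\<^sub>j\<^sup>2\<close>, so their product stays
  the same. The identity holds for every data matrix, singular Gram matrices included, which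
  spares an almost-sure invertibility argument.\<close>

lemma T_comp_row_transform:
  fixes G :: "real ^ ('p::finite + 'k::finite) ^ ('p + 'k)" and Y :: "real ^ 't ^ ('p + 'k)"
    and d :: "real ^ 'p"
  assumes G: "invertible G" and d: "\<And>j. d $ j \<noteq> 0"
    and col: "\<And>j. column (Inl j) G = d $ j *s axis (Inl j) 1"
  shows "T_comp (G ** Y) j = T_comp Y j"
proof -
  have gram: "(G ** Y) ** transpose (G ** Y) = G ** (Y ** transpose Y) ** transpose G"
    by (simp add: matrix_transpose_mul matrix_mul_assoc)
  show ?thesis
  proof (cases "invertible (Y ** transpose Y)")
    case False
    then have "\<not> invertible ((G ** Y) ** transpose (G ** Y))"
      using G by (simp add: gram invertible_congruence_iff)
    \<comment> \<open>Both inverses are the same default value.\<close>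
    with False have "V_matrix (G ** Y) = V_matrix Y"
      by (simp add: V_matrix_eq matrix_inv_singular)
    then show ?thesis by (simp add: T_comp_def)
  next
    case True
    define U where "U = upper_left (V_matrix Y)"
    define U' where "U' = upper_left (V_matrix (G ** Y))"
    have inv': "invertible ((G ** Y) ** transpose (G ** Y))"
      using G True by (simp add: gram invertible_congruence_iff)
    have "V_matrix Y = transpose G ** V_matrix (G ** Y) ** G"
      using matrix_inv_congruence[OF True G] by (simp add: V_matrix_eq gram)
    then have ent: "U $ a $ b = d $ a * d $ b * U' $ a $ b" for a b
      by (simp add: U_def U'_def upper_left_def congruence_entry_scaled_columns[OF col col])
    have "U $ a $ b = (diag d ** U' ** transpose (diag d)) $ a $ b" for a b
      by (simp add: ent transpose_diag
          congruence_entry_scaled_columns[OF diag_column diag_column, unfolded transpose_diag])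
    then have "U = diag d ** U' ** transpose (diag d)"
      by (simp add: vec_eq_iff)
    moreover have "invertible U'"
      using invertible_upper_left_matrix_inv_gram[OF inv'] by (simp add: U'_def V_matrix_eq)
    ultimately have "matrix_inv U' = transpose (diag d) ** matrix_inv U ** diag d"
      using matrix_inv_congruence[of U' "diag d"] invertible_diag[OF d] by simp
    then have "matrix_inv U' $ j $ j = d $ j * d $ j * matrix_inv U $ j $ j"
      by (simp add: congruence_entry_scaled_columns[OF diag_column diag_column])
    then have "U' $ j $ j * matrix_inv U' $ j $ j = U $ j $ j * matrix_inv U $ j $ j"
      using ent[of j j] by (simp add: algebra_simps)
    then show ?thesis
      by (simp add: T_comp_def Let_def flip: U_def U'_def)
  qed
qed

text \<open>The block matrix with rows \<open>(diag d, B)\<close> and \<open>(0, I)\<close>. It maps an idiosyncratic vector \<open>x\<close>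
  stacked on a factor vector \<open>y\<close> to the observation \<open>(diag d) x + B y\<close> stacked on \<open>y\<close>.\<close>

definition obs_map :: "real ^ 'p \<Rightarrow> real ^ 'k ^ 'p \<Rightarrow> real ^ ('p::finite + 'k::finite) ^ ('p + 'k)" where
  "obs_map d B = (\<chi> i j. case i of
       Inl a \<Rightarrow> (case j of Inl b \<Rightarrow> diag d $ a $ b | Inr l \<Rightarrow> B $ a $ l)
     | Inr l \<Rightarrow> (case j of Inl b \<Rightarrow> 0 | Inr m \<Rightarrow> mat 1 $ l $ m))"

lemma diag_mult_component: "(diag d *v x) $ j = d $ j * x $ j"
  by (simp add: diag_def matrix_vector_mult_def if_distrib[of "\<lambda>x. x * _"] cong: if_cong)

lemma obs_map_mult: "obs_map d B *v stack x y = stack (diag d *v x + B *v y) y"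
proof -
  have "(obs_map d B *v stack x y) $ i = stack (diag d *v x + B *v y) y $ i" for i
    by (cases i) (simp_all add: obs_map_def stack_def matrix_vector_mult_def sum_UNIV_Plus mat_def
      if_distrib[of "\<lambda>x. x * _"] cong: if_cong)
  then show ?thesis by (simp add: vec_eq_iff)
qed

lemma stack_exhaust: "\<exists>x y. z = stack x y"
  by (rule exI[of _ "\<chi> j. z $ Inl j"], rule exI[of _ "\<chi> l. z $ Inr l"])
    (simp add: stack_def vec_eq_iff split: sum.split)

lemma stack_eq_0_iff: "stack x y = 0 \<longleftrightarrow> x = 0 \<and> y = 0"
  by (auto simp: stack_def vec_eq_iff split: sum.split)

lemma invertible_obs_map:
  assumes "\<And>j. d $ j \<noteq> 0"
  shows "invertible (obs_map d B)"
  unfolding invertible_left_inverse matrix_left_invertible_ker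
proof (intro allI impI)
  fix z assume z: "obs_map d B *v z = 0"
  obtain x y where xy: "z = stack x y" using stack_exhaust by blast
  then have "diag d *v x + B *v y = 0 \<and> y = 0"
    using z by (metis obs_map_mult stack_eq_0_iff)
  then have y: "y = 0" and "diag d *v x = 0" by auto
  then have "d $ j * x $ j = 0" for j
    by (metis diag_mult_component zero_index)
  then have "x = 0" using assms by (simp add: vec_eq_iff)
  then show "z = 0" by (simp add: xy y stack_eq_0_iff)
qed

lemma column_obs_map: "column (Inl j) (obs_map d B) = d $ j *s axis (Inl j) 1"
  by (auto simp: column_def obs_map_def diag_def axis_def vec_eq_iff split: sum.split)

text \<open>Neither the loading matrix nor the scales of the idiosyncratic components are visible to \<^const>\<open>T_pr\<close>.\<close>

lemma T_pr_factor_invariant: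
  fixes F :: "'t::finite \<Rightarrow> real ^ 'k::finite" and N :: "'t \<Rightarrow> real ^ 'p::finite"
  assumes d: "\<And>j. d $ j \<noteq> 0"
  shows "T_pr (\<chi> i t. stack (diag d *v N t + B *v F t) (F t) $ i)
       = T_pr (\<chi> i t. stack (N t) (F t) $ i)"
proof -
  have "(obs_map d B ** (\<chi> i t. stack (N t) (F t) $ i)) $ i $ t = (obs_map d B *v stack (N t) (F t)) $ i" for i t
    by (simp add: matrix_matrix_mult_def matrix_vector_mult_def)
  then have "(\<chi> i t. stack (diag d *v N t + B *v F t) (F t) $ i)
      = obs_map d B ** (\<chi> i t. stack (N t) (F t) $ i)"
    by (simp add: vec_eq_iff obs_map_mult)
  then show ?thesis
    unfolding T_pr_def
    by (simp add: T_comp_row_transform[OF invertible_obs_map[OF d] d column_obs_map])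
qed

section \<open>Measurability of the statistic\<close>

lemma borel_measurable_vecI:
  fixes g :: "'a \<Rightarrow> 'b::euclidean_space ^ 'n"
  assumes "\<And>i. (\<lambda>x. g x $ i) \<in> borel_measurable M"
  shows "g \<in> borel_measurable M"
proof (rule borel_measurable_euclidean_space[THEN iffD2, rule_format])
  fix b :: "'b ^ 'n" assume "b \<in> Basis"
  then obtain i c where "b = axis i c" by (auto simp: Basis_vec_def)
  then show "(\<lambda>x. g x \<bullet> b) \<in> borel_measurable M"
    using assms[of i] by (simp add: inner_axis)
qed

lemma borel_measurable_vec_nth [measurable (raw)]:
  fixes g :: "'a \<Rightarrow> 'b::euclidean_space ^ 'n"
  assumes "g \<in> borel_measurable M"
  shows "(\<lambda>x. g x $ i) \<in> borel_measurable M"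
  using assms
  by (rule measurable_compose) (rule borel_measurable_continuous_onI[OF continuous_on_component[OF continuous_on_id]])

lemma borel_measurable_det:
  fixes A :: "'a \<Rightarrow> real ^ 'n ^ 'n"
  assumes "A \<in> borel_measurable M"
  shows "(\<lambda>x. det (A x)) \<in> borel_measurable M"
  unfolding det_def using assms
  by (intro borel_measurable_sum borel_measurable_times borel_measurable_prod
      borel_measurable_const borel_measurable_vec_nth)

lemma matrix_inv_cramer:
  fixes A :: "real ^ 'n ^ 'n"
  assumes "invertible A"
  shows "matrix_inv A $ i $ j = det (\<chi> k l. if l = i then axis j 1 $ k else A $ k $ l) / det A"
proof -
  have "A *v (matrix_inv A *v axis j 1) = axis j 1"
    by (simp add: matrix_vector_mul_assoc matrix_inv_mult_self[OF assms])
  moreover have "det A \<noteq> 0" using assms by (simp add: invertible_det_nz)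
  ultimately have "matrix_inv A *v axis j 1
      = (\<chi> i. det (\<chi> k l. if l = i then axis j 1 $ k else A $ k $ l) / det A)"
    using cramer by blast
  then have "(matrix_inv A *v axis j 1) $ i
      = det (\<chi> k l. if l = i then axis j 1 $ k else A $ k $ l) / det A" by simp
  then show ?thesis by (simp add: matrix_vector_mul_component inner_axis)
qed

text \<open>By Cramer's rule on the invertible matrices, and constant on the singular ones.\<close>

lemma borel_measurable_matrix_inv:
  fixes A :: "'a \<Rightarrow> real ^ 'n ^ 'n"
  assumes [measurable]: "A \<in> borel_measurable M"
  shows "(\<lambda>x. matrix_inv (A x)) \<in> borel_measurable M"
proof (intro borel_measurable_vecI)
  fix i j
  define N where "N x = (\<chi> k l. if l = i then axis j 1 $ k else A x $ k $ l)" for x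
  have entry: "matrix_inv (A x) $ i $ j
      = (if det (A x) = 0 then (SOME C :: real ^ 'n ^ 'n. False) $ i $ j else det (N x) / det (A x))" for x
    using matrix_inv_cramer[of "A x" i j] matrix_inv_singular[of "A x"]
    by (simp add: invertible_det_nz N_def)
  have "N \<in> borel_measurable M"
    by (intro borel_measurable_vecI) (simp add: N_def)
  note [measurable] = borel_measurable_det[OF this] borel_measurable_det[OF assms]
  show "(\<lambda>x. matrix_inv (A x) $ i $ j) \<in> borel_measurable M"
    unfolding entry by measurable
qed

lemma borel_measurable_T_pr:
  fixes Y :: "'a \<Rightarrow> real ^ 't ^ ('p::finite + 'k::finite)"
  assumes [measurable]: "Y \<in> borel_measurable M"
  shows "(\<lambda>x. T_pr (Y x)) \<in> borel_measurable M"
proof -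
  have "(\<lambda>x. Y x ** transpose (Y x)) \<in> borel_measurable M"
    by (intro borel_measurable_vecI) (simp add: matrix_matrix_mult_def transpose_def)
  then have [measurable]: "(\<lambda>x. V_matrix (Y x)) \<in> borel_measurable M"
    unfolding V_matrix_eq by (rule borel_measurable_matrix_inv)
  have [measurable]: "(\<lambda>x. upper_left (V_matrix (Y x))) \<in> borel_measurable M"
    by (intro borel_measurable_vecI) (simp add: upper_left_def)
  then have [measurable]: "(\<lambda>x. matrix_inv (upper_left (V_matrix (Y x)))) \<in> borel_measurable M"
    by (rule borel_measurable_matrix_inv)
  have "(\<lambda>x. T_comp (Y x) j) \<in> borel_measurable M" for j
    unfolding T_comp_def Let_def by measurable
  then show ?thesis unfolding T_pr_def by (intro borel_measurable_Max) simp_all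
qed

section \<open>Standardising a normal vector with diagonal covariance\<close>

lemma pos_def_matrix_diagonal_pos:
  assumes "pos_def_matrix \<Sigma>"
  shows "\<Sigma> $ j $ j > 0"
proof -
  have "axis j 1 \<bullet> (\<Sigma> *v axis j (1::real)) > 0"
    using assms unfolding pos_def_matrix_def by (simp add: axis_eq_0_iff)
  then show ?thesis
    by (simp add: inner_axis' matrix_vector_mul_component inner_axis)
qed

lemma matrix_inv_diag:
  assumes "\<And>j. d $ j \<noteq> (0::real)"
  shows "matrix_inv (diag d) = diag (\<chi> j. inverse (d $ j))"
  using assms by (intro matrix_inv_eqI)
    (simp add: diag_def matrix_matrix_mult_def mat_def vec_eq_iff if_distrib[of "\<lambda>x. x * _"] cong: if_cong)

text \<open>The factor \<open>\<Prod>s\<^sub>j\<close> is the Jacobian of \<open>y \<mapsto> (diag s) y\<close>.\<close>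

lemma mv_normal_density_diag_scale:
  fixes s :: "real ^ 'n"
  assumes s: "\<And>j. s $ j > 0"
  shows "(\<Prod>j\<in>UNIV. s $ j) * mv_normal_density 0 (diag (\<chi> j. (s $ j)\<^sup>2)) (diag s *v y)
       = mv_normal_density 0 (mat 1) y"
proof -
  let ?C = "\<Prod>j\<in>UNIV. s $ j"
  have C: "?C > 0" using s by (simp add: prod_pos)
  have s0: "s $ j \<noteq> 0" for j using s[of j] by simp
  have inv: "matrix_inv (diag (\<chi> j. (s $ j)\<^sup>2)) = diag (\<chi> j. inverse ((s $ j)\<^sup>2))"
    using s0 by (simp add: matrix_inv_diag)
  have "(diag s *v y) \<bullet> (diag (\<chi> j. inverse ((s $ j)\<^sup>2)) *v (diag s *v y)) = y \<bullet> y"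
    using s0 by (simp add: inner_vec_def diag_mult_component power2_eq_square field_simps)
  moreover have "matrix_inv (mat 1 :: real ^ 'n ^ 'n) = mat 1"
    by (rule matrix_inv_eqI) simp
  moreover have "det (diag (\<chi> j. (s $ j)\<^sup>2)) = ?C\<^sup>2"
    by (simp add: diag_def det_diagonal prod_power_distrib)
  ultimately show ?thesis
    using C s0 by (simp add: mv_normal_density_def inv real_sqrt_mult)
qed

lemma nn_integral_lborel_diag_scale:
  fixes s :: "real ^ 'n"
  assumes s: "\<And>j. s $ j > 0" and [measurable]: "g \<in> borel_measurable borel"
  shows "(\<integral>\<^sup>+x. g x \<partial>lborel) = (\<integral>\<^sup>+y. ennreal (\<Prod>j\<in>UNIV. s $ j) * g (diag s *v y) \<partial>lborel)"
proof -
  have "(\<Sum>b\<in>Basis. ((s \<bullet> b) * (x \<bullet> b)) *\<^sub>R b) $ i = (diag s *v x) $ i" for x i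
  proof -
    have "(\<Sum>b\<in>Basis. ((s \<bullet> b) * (x \<bullet> b)) *\<^sub>R b) \<bullet> axis i 1 = (s \<bullet> axis i 1) * (x \<bullet> axis i 1)"
      by (rule inner_sum_left_Basis) simp
    then show ?thesis by (simp add: inner_axis diag_mult_component)
  qed
  then have T: "(\<lambda>x. 0 + (\<Sum>b\<in>Basis. ((s \<bullet> b) * (x \<bullet> b)) *\<^sub>R b)) = (\<lambda>x. diag s *v x)"
    by (simp add: vec_eq_iff fun_eq_iff)
  have [measurable]: "(\<lambda>x. diag s *v x) \<in> borel \<rightarrow>\<^sub>M borel"
    unfolding T[symmetric] by measurable
  have basis: "(Basis :: (real ^ 'n) set) = range (\<lambda>i. axis i 1)"
    by (auto simp: Basis_vec_def)
  have "(\<Prod>b\<in>Basis. \<bar>s \<bullet> b\<bar>) = (\<Prod>i\<in>UNIV. \<bar>s \<bullet> axis i 1\<bar>)"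
    unfolding basis by (rule prod.reindex_cong[OF _ refl refl]) (auto simp: inj_on_def axis_eq_axis)
  also have "\<dots> = (\<Prod>i\<in>UNIV. s $ i)"
    using s by (intro prod.cong) (simp_all add: inner_axis abs_of_pos)
  finally have C: "(\<Prod>b\<in>Basis. \<bar>s \<bullet> b\<bar>) = (\<Prod>i\<in>UNIV. s $ i)" .
  have "s \<bullet> b \<noteq> 0" if "b \<in> Basis" for b
    using that s by (auto simp: basis inner_axis less_imp_neq[symmetric])
  then have "lborel = density (distr lborel borel (\<lambda>x. diag s *v x)) (\<lambda>_. ennreal (\<Prod>i\<in>UNIV. s $ i))"
    using lborel_affine_euclidean[of "\<lambda>b. s \<bullet> b" 0] unfolding T C by simp
  then have "(\<integral>\<^sup>+x. g x \<partial>lborel)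
      = (\<integral>\<^sup>+x. g x \<partial>density (distr lborel borel (\<lambda>x. diag s *v x)) (\<lambda>_. ennreal (\<Prod>i\<in>UNIV. s $ i)))"
    by simp
  also have "\<dots> = (\<integral>\<^sup>+y. ennreal (\<Prod>j\<in>UNIV. s $ j) * g (diag s *v y) \<partial>lborel)"
    by (simp add: nn_integral_density nn_integral_distr)
  finally show ?thesis .
qed

lemma borel_measurable_diag_mult [measurable]: "(\<lambda>x. diag d *v x) \<in> borel \<rightarrow>\<^sub>M borel"
  by (intro borel_measurable_continuous_onI continuous_intros)

lemma distr_standardised_normal:
  fixes Z :: "'a \<Rightarrow> real ^ 'n"
  assumes normal: "mv_normal M Z 0 \<Sigma>" and diagonal: "diagonal_matrix \<Sigma>"
  shows "distr M borel (\<lambda>w. diag (\<chi> j. inverse (sqrt (\<Sigma> $ j $ j))) *v Z w)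
       = density lborel (\<lambda>x. ennreal (mv_normal_density 0 (mat 1) x))"
proof -
  define s where "s = (\<chi> j. sqrt (\<Sigma> $ j $ j))"
  define r where "r = (\<chi> j. inverse (sqrt (\<Sigma> $ j $ j)))"
  let ?g = "mv_normal_density 0 \<Sigma>"
  have pos: "\<Sigma> $ j $ j > 0" for j
    using normal by (auto simp: mv_normal_def intro: pos_def_matrix_diagonal_pos)
  then have s: "s $ j > 0" for j by (simp add: s_def)
  have \<Sigma>: "\<Sigma> = diag (\<chi> j. (s $ j)\<^sup>2)"
    using diagonal pos by (auto simp: diag_def diagonal_matrix_def s_def vec_eq_iff less_imp_le)
  have rs: "diag r *v (diag s *v y) = y" for y
    using pos by (simp add: vec_eq_iff diag_mult_component r_def s_def less_imp_neq[symmetric])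
  have distd: "distributed M lborel Z (\<lambda>x. ennreal (?g x))"
    using normal by (simp add: mv_normal_def)
  then have [measurable]: "Z \<in> M \<rightarrow>\<^sub>M borel" and g [measurable]: "(\<lambda>x. ennreal (?g x)) \<in> borel_measurable borel"
    and dens: "distr M lborel Z = density lborel (\<lambda>x. ennreal (?g x))"
    by (auto simp: distributed_def)
  have scaled: "ennreal (\<Prod>j\<in>UNIV. s $ j) * ennreal (?g (diag s *v y)) = ennreal (mv_normal_density 0 (mat 1) y)" for y
    unfolding mv_normal_density_diag_scale[OF s, of y, symmetric] \<Sigma>[symmetric]
    using s by (intro ennreal_mult'[symmetric]) (simp add: prod_nonneg less_imp_le)
  have [measurable]: "(\<lambda>y. ennreal (mv_normal_density 0 (mat 1) y)) \<in> borel_measurable (borel :: (real^'n) measure)"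
    unfolding scaled[symmetric] by measurable
  show ?thesis unfolding r_def[symmetric]
  proof (rule measure_eqI)
    fix A assume "A \<in> sets (distr M borel (\<lambda>w. diag r *v Z w))"
    then have [measurable]: "A \<in> sets borel" by simp
    have "emeasure (distr M borel (\<lambda>w. diag r *v Z w)) A = emeasure (distr (distr M lborel Z) borel (\<lambda>x. diag r *v x)) A"
      by (simp add: distr_distr comp_def)
    also have "\<dots> = (\<integral>\<^sup>+y. indicator A y \<partial>distr (distr M lborel Z) borel (\<lambda>x. diag r *v x))"
      by simp
    also have "\<dots> = (\<integral>\<^sup>+x. ennreal (?g x) * indicator A (diag r *v x) \<partial>lborel)"
      unfolding dens by (simp add: nn_integral_distr nn_integral_density del: nn_integral_indicator)
    also have "\<dots> = (\<integral>\<^sup>+y. ennreal (\<Prod>j\<in>UNIV. s $ j) * (ennreal (?g (diag s *v y)) * indicator A (diag r *v (diag s *v y))) \<partial>lborel)"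
      by (rule nn_integral_lborel_diag_scale[OF s]) measurable
    also have "\<dots> = (\<integral>\<^sup>+y. ennreal (mv_normal_density 0 (mat 1) y) * indicator A y \<partial>lborel)"
      by (simp add: rs scaled flip: mult.assoc)
    finally show "emeasure (distr M borel (\<lambda>w. diag r *v Z w)) A
        = emeasure (density lborel (\<lambda>x. ennreal (mv_normal_density 0 (mat 1) x))) A"
      by (simp add: emeasure_density)
  qed simp
qed

section \<open>Joint laws of independent families\<close>

lemma (in prob_space) indep_set_vimage_algebra_compose:
  assumes indep: "indep_set (sets (vimage_algebra (space M) X N1)) (sets (vimage_algebra (space M) Y N2))"
    and Y: "Y \<in> M \<rightarrow>\<^sub>M N2" and g: "g \<in> N2 \<rightarrow>\<^sub>M N3"
  shows "indep_set (sets (vimage_algebra (space M) X N1)) (sets (vimage_algebra (space M) (\<lambda>w. g (Y w)) N3))"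
proof -
  have "Y \<in> vimage_algebra (space M) Y N2 \<rightarrow>\<^sub>M N2"
    using Y by (intro measurable_vimage_algebra1) (auto dest: measurable_space)
  then have "(\<lambda>w. g (Y w)) \<in> vimage_algebra (space M) Y N2 \<rightarrow>\<^sub>M N3"
    using g by simp
  then have "sets (vimage_algebra (space M) (\<lambda>w. g (Y w)) N3) \<subseteq> sets (vimage_algebra (space M) Y N2)"
    by (intro sets_image_in_sets) simp_all
  with indep show ?thesis unfolding indep_sets2_eq by blast
qed

text \<open>The variables may take values in different types.\<close>

lemma (in prob_space) distr_Pair_indep_set:
  assumes indep: "indep_set (sets (vimage_algebra (space M) X N1)) (sets (vimage_algebra (space M) Y N2))"
    and X [measurable]: "X \<in> M \<rightarrow>\<^sub>M N1" and Y [measurable]: "Y \<in> M \<rightarrow>\<^sub>M N2"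
  shows "distr M (N1 \<Otimes>\<^sub>M N2) (\<lambda>w. (X w, Y w)) = distr M N1 X \<Otimes>\<^sub>M distr M N2 Y"
proof (rule pair_measure_eqI[symmetric])
  show "sigma_finite_measure (distr M N1 X)" "sigma_finite_measure (distr M N2 Y)"
    using prob_space_distr[OF X] prob_space_distr[OF Y] by (simp_all add: prob_space_imp_sigma_finite)
  show "sets (distr M N1 X \<Otimes>\<^sub>M distr M N2 Y) = sets (distr M (N1 \<Otimes>\<^sub>M N2) (\<lambda>w. (X w, Y w)))"
    by (simp cong: sets_pair_measure_cong)
  fix A C assume "A \<in> sets (distr M N1 X)" "C \<in> sets (distr M N2 Y)"
  then have [measurable]: "A \<in> sets N1" "C \<in> sets N2" by simp_all
  have "prob ((X -` A \<inter> space M) \<inter> (Y -` C \<inter> space M)) = prob (X -` A \<inter> space M) * prob (Y -` C \<inter> space M)"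
    by (rule indep_setD[OF indep]) (simp_all add: in_vimage_algebra)
  moreover have "(\<lambda>w. (X w, Y w)) -` (A \<times> C) \<inter> space M = (X -` A \<inter> space M) \<inter> (Y -` C \<inter> space M)"
    by auto
  ultimately show "emeasure (distr M N1 X) A * emeasure (distr M N2 Y) C
      = emeasure (distr M (N1 \<Otimes>\<^sub>M N2) (\<lambda>w. (X w, Y w))) (A \<times> C)"
    by (simp add: emeasure_distr emeasure_eq_measure ennreal_mult)
qed

lemma (in prob_space) distr_indep_family:
  fixes Z :: "'t::finite \<Rightarrow> 'a \<Rightarrow> 'b"
  assumes "indep_vars (\<lambda>_. N) Z UNIV" and law: "\<And>t. distr M N (Z t) = L"
  shows "distr M (PiM UNIV (\<lambda>_. N)) (\<lambda>w t. Z t w) = PiM UNIV (\<lambda>_. L)"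
proof -
  have "random_variable N (Z t)" for t using assms(1) by (auto simp: indep_vars_def)
  then show ?thesis
    using indep_vars_iff_distr_eq_PiM'[where I = UNIV and M' = "\<lambda>_. N" and X = Z] assms(1)
    by (simp add: law restrict_UNIV)
qed

section \<open>The law of the statistic\<close>

text \<open>The right-hand side depends on the model only through the covariance matrix of the factors.
  The representation uses the standardised vectors \<open>N\<^sub>t = diag(1 / sqrt \<sigma>\<^sub>j\<^sub>j) u\<^sub>t\<close>.\<close>

lemma (in factor_model) distr_T_pr:
  assumes diagonal: "diagonal_matrix \<Sigma>u"
  shows "distr M borel (\<lambda>w. T_pr (data_matrix (obs X f) w)) =
    distr (PiM UNIV (\<lambda>_::'t. density lborel (\<lambda>x. ennreal (mv_normal_density 0 \<Sigma>f x)))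
        \<Otimes>\<^sub>M PiM UNIV (\<lambda>_::'t. density lborel (\<lambda>x. ennreal (mv_normal_density 0 (mat 1) x)))) borel
      (\<lambda>(F, N). T_pr (\<chi> i t. stack (N t :: real ^ 'p) (F t :: real ^ 'k) $ i))"
proof -
  define r where "r = (\<chi> j. inverse (sqrt (\<Sigma>u $ j $ j)))"
  define s where "s = (\<chi> j. sqrt (\<Sigma>u $ j $ j))"
  define N where "N t w = diag r *v u t w" for t w
  define H where "H = (\<lambda>(F :: 't \<Rightarrow> real ^ 'k, N :: 't \<Rightarrow> real ^ 'p). T_pr (\<chi> i t. stack (N t) (F t) $ i))"
  let ?Pf = "PiM UNIV (\<lambda>_::'t. borel :: (real ^ 'k) measure)"
  let ?Pu = "PiM UNIV (\<lambda>_::'t. borel :: (real ^ 'p) measure)"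
  have pos: "\<Sigma>u $ j $ j > 0" for j
    using u_normal by (auto simp: mv_normal_def intro: pos_def_matrix_diagonal_pos)
  have sr: "u t w = diag s *v N t w" for t w
    using pos by (simp add: N_def vec_eq_iff diag_mult_component r_def s_def less_imp_neq[symmetric])
  have s0: "s $ j \<noteq> 0" for j using pos[of j] by (simp add: s_def)
  have f_meas [measurable]: "f t \<in> M \<rightarrow>\<^sub>M borel" and u_meas [measurable]: "u t \<in> M \<rightarrow>\<^sub>M borel" for t
    using f_indep u_indep by (auto simp: indep_vars_def)
  have fw [measurable]: "(\<lambda>w t. f t w) \<in> M \<rightarrow>\<^sub>M ?Pf" and uw [measurable]: "(\<lambda>w t. u t w) \<in> M \<rightarrow>\<^sub>M ?Pu"
    by (auto intro!: measurable_PiM_single')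
  have g [measurable]: "(\<lambda>n t. diag r *v n t) \<in> ?Pu \<rightarrow>\<^sub>M ?Pu"
    by (intro measurable_PiM_single') (auto intro!: measurable_compose[OF measurable_component_singleton])
  have [measurable]: "(\<lambda>w t. N t w) \<in> M \<rightarrow>\<^sub>M ?Pu"
    unfolding N_def using measurable_compose[OF uw g] by simp
  have H [measurable]: "H \<in> ?Pf \<Otimes>\<^sub>M ?Pu \<rightarrow>\<^sub>M borel"
  proof -
    have comp: "(\<lambda>z. fst z t) \<in> ?Pf \<Otimes>\<^sub>M ?Pu \<rightarrow>\<^sub>M borel" "(\<lambda>z. snd z t) \<in> ?Pf \<Otimes>\<^sub>M ?Pu \<rightarrow>\<^sub>M borel" for t
      by measurable
    have "(\<lambda>z. stack (snd z t) (fst z t) $ i) \<in> borel_measurable (?Pf \<Otimes>\<^sub>M ?Pu)" for i t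
      by (cases i) (simp_all add: stack_def borel_measurable_vec_nth comp)
    then have "(\<lambda>z. \<chi> i t. stack (snd z t) (fst z t) $ i) \<in> borel_measurable (?Pf \<Otimes>\<^sub>M ?Pu)"
      by (intro borel_measurable_vecI) simp
    then show ?thesis
      unfolding H_def case_prod_beta by (rule borel_measurable_T_pr)
  qed
  have f_law: "distr M borel (f t) = density lborel (\<lambda>x. ennreal (mv_normal_density 0 \<Sigma>f x))" for t
    using f_normal[of t] by (simp add: mv_normal_def distributed_def cong: distr_cong)
  have N_indep: "indep_vars (\<lambda>_. borel) N UNIV"
    using indep_vars_compose2[OF u_indep, of "\<lambda>_ x. diag r *v x" "\<lambda>_. borel"]
    by (simp add: N_def[abs_def])
  have N_law: "distr M borel (N t) = density lborel (\<lambda>x. ennreal (mv_normal_density 0 (mat 1) x))" for t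
    using distr_standardised_normal[OF u_normal[of t] diagonal] by (simp add: N_def[abs_def] r_def)
  have "indep_set (sets (vimage_algebra (space M) (\<lambda>w t. f t w) ?Pf))
      (sets (vimage_algebra (space M) (\<lambda>w t. N t w) ?Pu))"
    using indep_set_vimage_algebra_compose[OF fu_indep uw g] by (simp add: N_def)
  then have joint: "distr M (?Pf \<Otimes>\<^sub>M ?Pu) (\<lambda>w. (\<lambda>t. f t w, \<lambda>t. N t w))
      = PiM UNIV (\<lambda>_::'t. density lborel (\<lambda>x. ennreal (mv_normal_density 0 \<Sigma>f x)))
        \<Otimes>\<^sub>M PiM UNIV (\<lambda>_::'t. density lborel (\<lambda>x. ennreal (mv_normal_density 0 (mat 1) x)))"
    by (simp add: distr_Pair_indep_set distr_indep_family[OF f_indep f_law]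
        distr_indep_family[OF N_indep N_law])
  have "T_pr (data_matrix (obs X f) w) = H (\<lambda>t. f t w, \<lambda>t. N t w)" for w
  proof -
    have "data_matrix (obs X f) w = (\<chi> i t. stack (diag s *v N t w + B *v f t w) (f t w) $ i)"
      by (simp add: data_matrix_def obs_def X_eq sr add.commute)
    then show ?thesis by (simp add: H_def T_pr_factor_invariant[OF s0])
  qed
  then have "distr M borel (\<lambda>w. T_pr (data_matrix (obs X f) w))
      = distr (distr M (?Pf \<Otimes>\<^sub>M ?Pu) (\<lambda>w. (\<lambda>t. f t w, \<lambda>t. N t w))) borel H"
    by (subst distr_distr) (simp_all add: comp_def)
  then show ?thesis unfolding joint H_def .
qed

theorem theorem3:
  fixes M :: "'a measure" and M' :: "'b measure"
    and B :: "real ^ 'k ^ 'p"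
    and \<Sigma>f :: "real ^ 'k ^ 'k"
    and \<Sigma>u \<Sigma>u' :: "real ^ 'p ^ 'p"
    and f :: "'t::finite \<Rightarrow> 'a \<Rightarrow> real ^ 'k" and f' :: "'t \<Rightarrow> 'b \<Rightarrow> real ^ 'k"
    and u X :: "'t \<Rightarrow> 'a \<Rightarrow> real ^ 'p" and u' X' :: "'t \<Rightarrow> 'b \<Rightarrow> real ^ 'p"
    and \<omega> \<omega>' :: "real ^ 'p"
  assumes "CARD('p) \<ge> 2" and "CARD('p) + CARD('k) < CARD('t)"
    and "factor_model M B \<Sigma>f \<Sigma>u f u X" and "factor_model M' B \<Sigma>f \<Sigma>u' f' u' X'"
    and "diagonal_matrix \<Sigma>u" and "diagonal_matrix \<Sigma>u'"
    and "\<And>j. \<omega> $ j > 0" and "\<And>j. \<omega>' $ j > 0"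
    and "\<And>t. upper_left (precision_matrix M (obs X f t)) = diag \<omega>"
    and "\<And>t. upper_left (precision_matrix M' (obs X' f' t)) = diag \<omega>'"
  shows "distr M borel (\<lambda>w. T_pr (data_matrix (obs X f) w)) =
         distr M' borel (\<lambda>w. T_pr (data_matrix (obs X' f') w))"
  using factor_model.distr_T_pr[OF assms(3,5)] factor_model.distr_T_pr[OF assms(4,6)] by simp

end
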